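(* Every solution $\big(\{x_i(t)\}_{i=1}^N,y_0\big)$ of the one-leader system $$\frac{d}{dt}y_0(t)=0,\quad t>0,$$ $$\frac{d}{dt}x_i(t)=\frac1N\sum_{j\ne i}\chi_{ij}\,b_{ij}(t)\,\big(x_j(t-\tau_{ij})-x_i(t)\big)+\frac{c_{i0}(t)}{N}\,\big(y^0-x_i(t)\big),\quad t>0,\ i=1,\dots,N,$$ with initial conditions $y_0(0)=y^0$ and $x_i(t)=x_i^0(t)$ for $t\in[-\tau,0]$, $i=1,\dots,N$, satisfies the exponential decay estimate $$d(t)\le D_0\,e^{-\tilde\gamma(t-2\tau)}\quad\text{for all } t\ge0,$$ for a suitable positive constant $\tilde\gamma$.
   Context: Let $N\ge3$ be an integer, let $\mathbb{R}^d$ carry the Euclidean norm $|\cdot|$; $x_i(t)\in\mathbb{R}^d$, $i=1,\dots,N$, are the opinions of the non-leaders and $y_0(t)\in\mathbb{R}^d$ is the opinion of the leader, which is constantly equal to $y^0\in\mathbb{R}^d$. The delays $\tau_{ij}$, $i,j=1,\dots,N$, are positive constants and $\tau:=\max_{i,j=1,\dots,N}\tau_{ij}$. The coefficients $\chi_{ij}\in\{0,1\}$ are arbitrary ($\chi_{ij}=1$ if $j$ transmits information to $i$, $0$ otherwise). The weights are $b_{ij}(t):=\psi_{ij}(x_i(t),x_j(t-\tau_{ij}))$ and $c_{i0}(t):=\phi_{0i}(x_i(t),y^0)$, where $\psi_{ij},\phi_{0i}:\mathbb{R}^d\times\mathbb{R}^d\to\mathbb{R}$ are continuous, positive and bounded.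 The initial data $x_i^0:[-\tau,0]\to\mathbb{R}^d$ are continuous. A solution consists of continuous functions $x_i:[-\tau,\infty)\to\mathbb{R}^d$ equal to $x_i^0$ on $[-\tau,0]$, together with $y_0\equiv y^0$, satisfying the system for $t>0$. Notation: $$d(t):=\max\Big\{\max_{i=1,\dots,N}|x_i(t)-y^0|,\ \max_{i,j=1,\dots,N}|x_i(t)-x_j(t)|\Big\},$$ $$D_0:=\max\Big\{\max_{i,j=1,\dots,N}\ \max_{s,t\in[-\tau,0]}|x_i(s)-x_j(t)|,\ \max_{i=1,\dots,N}\ \max_{s\in[-\tau,0]}|x_i(s)-y^0|\Big\}.$$ *)

theory Defs
  imports "HOL-Analysis.Analysis"
begin

text \<open>
  Opinion dynamics with one leader and pairwise delays. The non-leaders are indexed by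
  \<open>{1..N}\<close>; values of the families below at other indices are never used.
\<close>

definition max_delay :: "nat \<Rightarrow> (nat \<Rightarrow> nat \<Rightarrow> real) \<Rightarrow> real" where
  "max_delay N \<tau> = Max ((\<lambda>(i, j). \<tau> i j) ` ({1..N} \<times> {1..N}))"

definition weight_b ::
  "(nat \<Rightarrow> nat \<Rightarrow> real) \<Rightarrow> (nat \<Rightarrow> nat \<Rightarrow> (real^'d) \<times> (real^'d) \<Rightarrow> real) \<Rightarrow>
   (nat \<Rightarrow> real \<Rightarrow> real^'d) \<Rightarrow> nat \<Rightarrow> nat \<Rightarrow> real \<Rightarrow> real" where
  "weight_b \<tau> \<psi> x i j t = \<psi> i j (x i t, x j (t - \<tau> i j))"

text \<open>\<open>\<phi> i\<close> stands for $\phi_{0i}$, the influence function of the leader on agent \<open>i\<close>.\<close>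

definition weight_c ::
  "(nat \<Rightarrow> (real^'d) \<times> (real^'d) \<Rightarrow> real) \<Rightarrow> real^'d \<Rightarrow>
   (nat \<Rightarrow> real \<Rightarrow> real^'d) \<Rightarrow> nat \<Rightarrow> real \<Rightarrow> real" where
  "weight_c \<phi> yinit x i t = \<phi> i (x i t, yinit)"

definition is_solution ::
  "nat \<Rightarrow> (nat \<Rightarrow> nat \<Rightarrow> real) \<Rightarrow> (nat \<Rightarrow> nat \<Rightarrow> real) \<Rightarrow>
   (nat \<Rightarrow> nat \<Rightarrow> (real^'d) \<times> (real^'d) \<Rightarrow> real) \<Rightarrow>
   (nat \<Rightarrow> (real^'d) \<times> (real^'d) \<Rightarrow> real) \<Rightarrow>
   (nat \<Rightarrow> real \<Rightarrow> real^'d) \<Rightarrow> real^'d \<Rightarrow>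
   (nat \<Rightarrow> real \<Rightarrow> real^'d) \<Rightarrow> (real \<Rightarrow> real^'d) \<Rightarrow> bool" where
  "is_solution N \<tau> chi \<psi> \<phi> xinit yinit x y0 \<longleftrightarrow>
     continuous_on {0..} y0 \<and> y0 0 = yinit \<and>
     (\<forall>t>0. (y0 has_vector_derivative 0) (at t)) \<and>
     (\<forall>i\<in>{1..N}.
        continuous_on {- max_delay N \<tau>..} (x i) \<and>
        (\<forall>t\<in>{- max_delay N \<tau>..0}. x i t = xinit i t) \<and>
        (\<forall>t>0. (x i has_vector_derivative
           ((1 / real N) *\<^sub>R
              (\<Sum>j\<in>{1..N} - {i}.
                 (chi i j * weight_b \<tau> \<psi> x i j t) *\<^sub>R (x j (t - \<tau> i j) - x i t))
            + (weight_c \<phi> yinit x i t / real N) *\<^sub>R (yinit - x i t))) (at t)))"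

definition diam_leader ::
  "nat \<Rightarrow> real^'d \<Rightarrow> (nat \<Rightarrow> real \<Rightarrow> real^'d) \<Rightarrow> real \<Rightarrow> real" where
  "diam_leader N yinit x t =
     max (Max ((\<lambda>i. norm (x i t - yinit)) ` {1..N}))
         (Max ((\<lambda>(i, j). norm (x i t - x j t)) ` ({1..N} \<times> {1..N})))"

text \<open>
  The suprema are over compact sets; for \<open>x i\<close> continuous on \<open>[-T, 0]\<close> with \<open>T \<ge> 0\<close>
  they are attained, i.e. they are the maxima. Here \<open>T\<close> is the maximal delay.
\<close>

definition diam_initial ::
  "nat \<Rightarrow> real \<Rightarrow> real^'d \<Rightarrow> (nat \<Rightarrow> real \<Rightarrow> real^'d) \<Rightarrow> real" where
  "diam_initial N T yinit x =
     max (Max ((\<lambda>(i, j). SUP (s, t)\<in>{-T..0} \<times> {-T..0}. norm (x i s - x j t))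
                 ` ({1..N} \<times> {1..N})))
         (Max ((\<lambda>i. SUP s\<in>{-T..0}. norm (x i s - yinit)) ` {1..N}))"

end

theory Submission
  imports Defs
begin

text \<open>
  Fix a vector \<open>v\<close> and consider the scalar projections \<open>v \<bullet> (x i t - yinit)\<close>. If they are at most
  \<open>M\<close> on the initial interval, where \<open>M \<ge> 0\<close>, then \<open>M * exp (- \<gamma> * t)\<close> is a supersolution of the
  projected system as soon as \<open>\<gamma>\<close> plus the total weight of the delayed terms times
  \<open>exp (\<gamma> * T) - 1\<close> is smaller than the weight of the leader. For \<open>\<gamma> = 0\<close> this only needs the weight
  of the leader to be positive, so the solution is bounded; by compactness the weight of the leader
  is then bounded away from zero, which makes some \<open>\<gamma> > 0\<close> admissible. Applying the estimate to
  \<open>v\<close> and to \<open>- v\<close>, where \<open>v\<close> is a difference of two opinions, bounds their distance by the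
  initial width in direction \<open>v\<close> times \<open>exp (- \<gamma> * t)\<close>. This is stronger than the claim, whose
  factor \<open>exp (2 * \<gamma> * T)\<close> is not needed.
\<close>

section \<open>Comparison by a first crossing time\<close>

text \<open>Finitely many continuous functions make the set of crossing times closed, so a violation
  would have a first time \<open>r\<close>, and the initial condition forces \<open>r > 0\<close>. A
  negative derivative there means the crossing function was even larger just before
  \<open>r\<close>, against minimality. The sign condition \<open>cross\<close> may assume
  negativity of all functions back to \<open>-T\<close>, which is what lets it handle delayed
  arguments.\<close>

lemma first_crossing_negative:
  fixes u :: "'i \<Rightarrow> real \<Rightarrow> real"
  assumes "finite I"
    and cont: "\<And>i. i \<in> I \<Longrightarrow> continuous_on {0..} (u i)"
    and init: "\<And>i s. i \<in> I \<Longrightarrow> s \<in> {-T..0} \<Longrightarrow> u i s < 0"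
    and T: "T \<ge> 0"
    and cross: "\<And>i t. i \<in> I \<Longrightarrow> t > 0 \<Longrightarrow> (\<forall>j\<in>I. \<forall>s\<in>{-T..<t}. u j s < 0) \<Longrightarrow> u i t \<ge> 0 \<Longrightarrow>
                  \<exists>D<0. (u i has_real_derivative D) (at t)"
    and i: "i \<in> I" and t: "t \<ge> -T"
  shows "u i t < 0"
proof (rule ccontr)
  assume "\<not> u i t < 0"
  define A where "A = (\<Union>j\<in>I. {s\<in>{0..}. 0 \<le> u j s})"
  have "t \<ge> 0"
    using init[OF i, of t] t \<open>\<not> u i t < 0\<close> by force
  then have ne: "A \<noteq> {}"
    using \<open>\<not> u i t < 0\<close> i by (auto simp: A_def not_less)
  have cl: "closed A"
    unfolding A_def using \<open>finite I\<close> cont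
    by (intro closed_UN ballI continuous_on_closed_Collect_le continuous_on_const closed_atLeast) auto
  have bb: "bdd_below A" by (rule bdd_belowI[of _ 0]) (auto simp: A_def)
  define r where "r = Inf A"
  have "r \<in> A" unfolding r_def using closed_contains_Inf[OF ne bb cl] .
  then obtain k where k: "k \<in> I" "0 \<le> r" "0 \<le> u k r" by (auto simp: A_def)
  have "r \<noteq> 0" using init[OF k(1), of 0] k T by force
  then have rpos: "r > 0" using k by simp
  have before: "\<forall>j\<in>I. \<forall>s\<in>{-T..<r}. u j s < 0"
  proof (intro ballI)
    fix j s assume js: "j \<in> I" "s \<in> {-T..<r}"
    have "s \<notin> A" using cInf_lower[OF _ bb, of s] js by (auto simp: r_def)
    then show "u j s < 0" using js init[of j s] by (cases "s \<le> 0") (auto simp: A_def not_le)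
  qed
  obtain D where D: "D < 0" "(u k has_real_derivative D) (at r)"
    using cross[OF k(1) rpos before k(3)] by blast
  obtain d where d: "d > 0" "\<And>h. 0 < h \<Longrightarrow> h < d \<Longrightarrow> u k r < u k (r - h)"
    using DERIV_neg_dec_left[OF D(2) D(1)] by blast
  define h where "h = min (d/2) (r/2)"
  have h: "0 < h" "h < d" "h < r" using d rpos by (auto simp: h_def)
  have "r - h \<in> {-T..<r}" using h T by auto
  then show False using d(2)[OF h(1,2)] before k by fastforce
qed

section \<open>The system projected onto one direction\<close>

lemma max_delay_ge:
  assumes "i \<in> {1..N}" "j \<in> {1..N}"
  shows "\<tau> i j \<le> max_delay N \<tau>"
  unfolding max_delay_def using assms by (intro Max_ge) auto

lemma solution_continuous_on:
  assumes "is_solution N \<tau> chi \<psi> \<phi> xinit yinit x y0" "i \<in> {1..N}" "S \<subseteq> {- max_delay N \<tau>..}"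
  shows "continuous_on S (x i)"
  using assms unfolding is_solution_def by (metis continuous_on_subset)

text \<open>Centering at \<open>yinit\<close> turns the leader's influence into pure damping and
  leaves the differences between agents unchanged.\<close>

lemma solution_inner_deriv:
  assumes "is_solution N \<tau> chi \<psi> \<phi> xinit yinit x y0" "i \<in> {1..N}" "t > 0"
  shows "((\<lambda>t. v \<bullet> (x i t - yinit)) has_real_derivative
           ((1 / real N) * (\<Sum>j\<in>{1..N} - {i}. chi i j * weight_b \<tau> \<psi> x i j t *
               (v \<bullet> (x j (t - \<tau> i j) - yinit) - v \<bullet> (x i t - yinit)))
             - weight_c \<phi> yinit x i t / real N * (v \<bullet> (x i t - yinit)))) (at t)"
proof -
  let ?X = "(1 / real N) *\<^sub>R
              (\<Sum>j\<in>{1..N} - {i}.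
                 (chi i j * weight_b \<tau> \<psi> x i j t) *\<^sub>R (x j (t - \<tau> i j) - x i t))
            + (weight_c \<phi> yinit x i t / real N) *\<^sub>R (yinit - x i t)"
  have "(x i has_vector_derivative ?X) (at t)"
    using assms by (auto simp: is_solution_def)
  then have "((\<lambda>t. x i t - yinit) has_vector_derivative ?X) (at t)"
    by (auto intro!: derivative_eq_intros)
  then have "((\<lambda>t. v \<bullet> (x i t - yinit)) has_vector_derivative v \<bullet> ?X) (at t)"
    by (rule bounded_linear.has_vector_derivative[OF bounded_linear_inner_right])
  moreover have "v \<bullet> ?X = (1 / real N) * (\<Sum>j\<in>{1..N} - {i}. chi i j * weight_b \<tau> \<psi> x i j t *
               (v \<bullet> (x j (t - \<tau> i j) - yinit) - v \<bullet> (x i t - yinit)))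
             - weight_c \<phi> yinit x i t / real N * (v \<bullet> (x i t - yinit))"
    by (simp add: inner_add_right inner_sum_right inner_diff_right right_diff_distrib)
  ultimately show ?thesis
    by (simp add: has_real_derivative_iff_has_vector_derivative)
qed

text \<open>The barrier is raised from \<open>M\<close> to \<open>M + e\<close>, which keeps it
  positive even for \<open>M = 0\<close> and makes the initial inequality strict. At a first contact
  the condition \<open>rate\<close> says that the damping by the leader outweighs both the delayed
  pull and the descent of the barrier.\<close>

lemma solution_inner_decay:
  assumes sol: "is_solution N \<tau> chi \<psi> \<phi> xinit yinit x y0"
    and \<tau>: "\<And>i j. i \<in> {1..N} \<Longrightarrow> j \<in> {1..N} \<Longrightarrow> \<tau> i j > 0"
    and weight: "\<And>i j t. i \<in> {1..N} \<Longrightarrow> j \<in> {1..N} \<Longrightarrow> 0 \<le> chi i j * weight_b \<tau> \<psi> x i j t"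
    and \<gamma>: "\<gamma> \<ge> 0"
    and rate: "\<And>i t. i \<in> {1..N} \<Longrightarrow> t > 0 \<Longrightarrow>
        (1 / real N) * (\<Sum>j\<in>{1..N} - {i}. chi i j * weight_b \<tau> \<psi> x i j t *
            (exp (\<gamma> * max_delay N \<tau>) - 1)) + \<gamma> < weight_c \<phi> yinit x i t / real N"
    and M: "M \<ge> 0"
    and init: "\<And>i s. i \<in> {1..N} \<Longrightarrow> s \<in> {- max_delay N \<tau>..0} \<Longrightarrow> v \<bullet> (x i s - yinit) \<le> M"
    and i: "i \<in> {1..N}" and t: "t \<ge> - max_delay N \<tau>"
  shows "v \<bullet> (x i t - yinit) \<le> M * exp (- \<gamma> * t)"
proof -
  define T where "T = max_delay N \<tau>"
  have T: "T \<ge> 0" using max_delay_ge[OF i i, of \<tau>] \<tau>[OF i i] by (simp add: T_def)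
  have strict: "v \<bullet> (x i t - yinit) - (M + e) * exp (- \<gamma> * t) < 0" if e: "e > 0" for e
  proof (rule first_crossing_negative[where u = "\<lambda>i t. v \<bullet> (x i t - yinit) - (M + e) * exp (- \<gamma> * t)"
        and I = "{1..N}" and T = T])
    fix j assume j: "j \<in> {1..N}"
    have "continuous_on {0..} (x j)"
      by (rule solution_continuous_on[OF sol j]) (use T in \<open>auto simp: T_def\<close>)
    then show "continuous_on {0..} (\<lambda>t. v \<bullet> (x j t - yinit) - (M + e) * exp (- \<gamma> * t))"
      by (intro continuous_intros)
  next
    fix j s assume j: "j \<in> {1..N}" and s: "s \<in> {-T..0}"
    \<comment> \<open>At nonpositive times the barrier is at least \<open>M + e\<close>, hence above
      the initial bound.\<close>
    have "1 \<le> exp (- \<gamma> * s)" using s \<gamma> by (simp add: mult_nonneg_nonpos)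
    then have "(M + e) * 1 \<le> (M + e) * exp (- \<gamma> * s)" using M e by (intro mult_left_mono) auto
    then show "v \<bullet> (x j s - yinit) - (M + e) * exp (- \<gamma> * s) < 0"
      using init[OF j, of s] s e by (simp add: T_def)
  next
    fix i t
    assume i: "i \<in> {1..N}" and t: "t > 0"
      and before: "\<forall>j\<in>{1..N}. \<forall>s\<in>{-T..<t}. v \<bullet> (x j s - yinit) - (M + e) * exp (- \<gamma> * s) < 0"
      and at: "v \<bullet> (x i t - yinit) - (M + e) * exp (- \<gamma> * t) \<ge> 0"
    define h where "h = (M + e) * exp (- \<gamma> * t)"
    define c where "c = weight_c \<phi> yinit x i t / real N"
    define a where "a = (\<lambda>j. chi i j * weight_b \<tau> \<psi> x i j t)"
    define f where "f = v \<bullet> (x i t - yinit)"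
    define F where "F = (\<lambda>j. v \<bullet> (x j (t - \<tau> i j) - yinit))"
    have h: "h > 0" using M e by (simp add: h_def)
    have fh: "f \<ge> h" using at by (simp add: f_def h_def)
    have a: "a j \<ge> 0" if "j \<in> {1..N}" for j using weight[OF i that] by (simp add: a_def)
    have r: "(1 / real N) * (\<Sum>j\<in>{1..N} - {i}. a j * (exp (\<gamma> * T) - 1)) + \<gamma> < c"
      using rate[OF i t] by (simp add: a_def c_def T_def)
    \<comment> \<open>Positivity is implicit in \<open>rate\<close>: all other terms there are
      nonnegative. It is what allows the damping \<open>c * f\<close> to be bounded below by
      \<open>c * h\<close>.\<close>
    have c: "c > 0"
    proof -
      have "0 \<le> (\<Sum>j\<in>{1..N} - {i}. a j * (exp (\<gamma> * T) - 1))"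
        using a \<gamma> T by (intro sum_nonneg mult_nonneg_nonneg) auto
      then have "0 \<le> (1 / real N) * (\<Sum>j\<in>{1..N} - {i}. a j * (exp (\<gamma> * T) - 1))" by simp
      then show ?thesis using r \<gamma> by linarith
    qed
    have F: "F j - f \<le> h * (exp (\<gamma> * T) - 1)" if j: "j \<in> {1..N}" for j
    proof -
      \<comment> \<open>Positive delays place the delayed argument strictly before the contact time,
        where every projection is still below the barrier.\<close>
      have "t - \<tau> i j \<in> {-T..<t}"
        using \<tau>[OF i j] max_delay_ge[OF i j, of \<tau>] t by (simp add: T_def)
      then have "F j \<le> (M + e) * exp (- \<gamma> * (t - \<tau> i j))"
        using before j unfolding F_def by fastforce
      also have "\<dots> = h * exp (\<gamma> * \<tau> i j)"
        by (simp add: h_def algebra_simps flip: exp_add)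
      also have "\<dots> \<le> h * exp (\<gamma> * T)"
        using max_delay_ge[OF i j, of \<tau>] \<gamma> h by (simp add: T_def mult_left_mono)
      finally show ?thesis using fh by (simp add: algebra_simps)
    qed
    have "(\<Sum>j\<in>{1..N} - {i}. a j * (F j - f)) \<le> (\<Sum>j\<in>{1..N} - {i}. a j * (h * (exp (\<gamma> * T) - 1)))"
      using a F by (intro sum_mono mult_left_mono) auto
    also have "\<dots> = h * (\<Sum>j\<in>{1..N} - {i}. a j * (exp (\<gamma> * T) - 1))"
      by (simp add: sum_distrib_left algebra_simps)
    finally have "(1 / real N) * (\<Sum>j\<in>{1..N} - {i}. a j * (F j - f))
        \<le> (1 / real N) * (h * (\<Sum>j\<in>{1..N} - {i}. a j * (exp (\<gamma> * T) - 1)))"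
      by (intro mult_left_mono) auto
    \<comment> \<open>Scaling \<open>rate\<close> by the barrier height is the source of strictness
      in \<open>neg\<close>.\<close>
    moreover have "h * ((1 / real N) * (\<Sum>j\<in>{1..N} - {i}. a j * (exp (\<gamma> * T) - 1)) + \<gamma>) < h * c"
      using r h by (intro mult_strict_left_mono) auto
    moreover have "c * h \<le> c * f" using c fh by (intro mult_left_mono) auto
    ultimately have neg: "(1 / real N) * (\<Sum>j\<in>{1..N} - {i}. a j * (F j - f)) - c * f + \<gamma> * h < 0"
      by (simp add: algebra_simps)
    have "((\<lambda>t. v \<bullet> (x i t - yinit) - (M + e) * exp (- \<gamma> * t)) has_real_derivative
        ((1 / real N) * (\<Sum>j\<in>{1..N} - {i}. a j * (F j - f)) - c * f) - (M + e) * (exp (- \<gamma> * t) * - \<gamma>)) (at t)"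
      unfolding a_def F_def f_def c_def
      by (intro DERIV_diff solution_inner_deriv[OF sol i t]) (auto intro!: derivative_eq_intros)
    moreover have "((1 / real N) * (\<Sum>j\<in>{1..N} - {i}. a j * (F j - f)) - c * f) - (M + e) * (exp (- \<gamma> * t) * - \<gamma>) < 0"
      using neg by (simp add: h_def algebra_simps)
    ultimately show "\<exists>D<0. ((\<lambda>t. v \<bullet> (x i t - yinit) - (M + e) * exp (- \<gamma> * t)) has_real_derivative D) (at t)"
      by blast
  qed (use T i t in \<open>auto simp: T_def\<close>)
  \<comment> \<open>Dividing by the exponential isolates \<open>M + e\<close>, so that
    \<open>e\<close> can tend to zero.\<close>
  have "(v \<bullet> (x i t - yinit)) / exp (- \<gamma> * t) \<le> M"
  proof (rule field_le_epsilon)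
    fix e :: real assume "e > 0"
    then show "(v \<bullet> (x i t - yinit)) / exp (- \<gamma> * t) \<le> M + e"
      using strict[of e] by (subst pos_divide_le_eq) auto
  qed
  then show ?thesis by (subst (asm) pos_divide_le_eq) auto
qed

section \<open>Diameters and widths of the initial data\<close>

text \<open>With \<open>M\<close> the supremum of \<open>v \<bullet> p\<close>, Cauchy-Schwarz on
  pairs shows that \<open>norm v * D - M\<close> serves as \<open>M'\<close>. Controlling the sum
  rather than each bound separately avoids losing a factor 2.\<close>

lemma inner_widths_le_diameter:
  fixes P :: "'a::real_inner set"
  assumes "P \<noteq> {}" and diam: "\<And>p q. p \<in> P \<Longrightarrow> q \<in> P \<Longrightarrow> norm (p - q) \<le> D"
  obtains M M' where "\<And>p. p \<in> P \<Longrightarrow> v \<bullet> p \<le> M" "\<And>p. p \<in> P \<Longrightarrow> - v \<bullet> p \<le> M'" "M + M' \<le> norm v * D"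
proof -
  have le: "v \<bullet> p \<le> norm v * D + v \<bullet> q" if "p \<in> P" "q \<in> P" for p q
  proof -
    have "v \<bullet> (p - q) \<le> norm v * norm (p - q)" by (rule norm_cauchy_schwarz)
    also have "\<dots> \<le> norm v * D" using diam[OF that] by (intro mult_left_mono) auto
    finally show ?thesis by (simp add: inner_diff_right)
  qed
  define M where "M = (SUP p\<in>P. v \<bullet> p)"
  obtain q0 where q0: "q0 \<in> P" using \<open>P \<noteq> {}\<close> by blast
  have "bdd_above ((\<bullet>) v ` P)" using le[OF _ q0] by (intro bdd_aboveI2)
  then have M: "v \<bullet> p \<le> M" if "p \<in> P" for p unfolding M_def using that by (intro cSUP_upper)
  have M': "M \<le> norm v * D + v \<bullet> q" if "q \<in> P" for q
    unfolding M_def using \<open>P \<noteq> {}\<close> le that by (intro cSUP_least) auto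
  show thesis
    by (rule that[of M "norm v * D - M"]) (use M M' in \<open>force simp: inner_minus_left\<close>)+
qed

text \<open>A real supremum dominates its family only if that family is bounded above; continuity on
  the compact initial interval provides the bounds.\<close>

lemma diam_initial_bounds:
  assumes cont: "\<And>i. i \<in> {1..N} \<Longrightarrow> continuous_on {-T..0} (x i)"
    and i: "i \<in> {1..N}" and s: "s \<in> {-T..0}"
  shows "norm (x i s - yinit) \<le> diam_initial N T yinit x"
    and "j \<in> {1..N} \<Longrightarrow> t \<in> {-T..0} \<Longrightarrow> norm (x i s - x j t) \<le> diam_initial N T yinit x"
proof -
  have "\<exists>B. \<forall>s\<in>{-T..0}. norm (x i s) \<le> B" if "i \<in> {1..N}" for i
    using compact_imp_bounded[OF compact_continuous_image[OF cont[OF that] compact_Icc]]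
    by (auto simp: bounded_iff)
  then obtain B where B: "\<And>i s. i \<in> {1..N} \<Longrightarrow> s \<in> {-T..0} \<Longrightarrow> norm (x i s) \<le> B i"
    by metis
  have "norm (x i s - yinit) \<le> (SUP s\<in>{-T..0}. norm (x i s - yinit))"
  proof (rule cSUP_upper[OF s], rule bdd_aboveI2)
    fix s assume "s \<in> {-T..0}"
    then show "norm (x i s - yinit) \<le> B i + norm yinit"
      using B[OF i, of s] norm_triangle_ineq4[of "x i s" yinit] by linarith
  qed
  also have "\<dots> \<le> Max ((\<lambda>i. SUP s\<in>{-T..0}. norm (x i s - yinit)) ` {1..N})"
    using i by (intro Max_ge) auto
  finally show "norm (x i s - yinit) \<le> diam_initial N T yinit x"
    by (simp add: diam_initial_def)
  assume j: "j \<in> {1..N}" and t: "t \<in> {-T..0}"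
  \<comment> \<open>The pair stays inside \<open>case\<close> so that the left side is literally the
    function under the supremum, applied to \<open>(s, t)\<close>.\<close>
  have "(case (s, t) of (s, t) \<Rightarrow> norm (x i s - x j t))
      \<le> (SUP (s, t)\<in>{-T..0} \<times> {-T..0}. norm (x i s - x j t))"
  proof (rule cSUP_upper, use s t in blast, rule bdd_aboveI2)
    fix p assume p: "p \<in> {-T..0} \<times> {-T..0}"
    then show "(case p of (s, t) \<Rightarrow> norm (x i s - x j t)) \<le> B i + B j"
      using B[OF i, of "fst p"] B[OF j, of "snd p"] norm_triangle_ineq4[of "x i (fst p)" "x j (snd p)"]
      by (auto split: prod.splits)
  qed
  also have "\<dots> \<le> Max ((\<lambda>(i, j). SUP (s, t)\<in>{-T..0} \<times> {-T..0}. norm (x i s - x j t)) ` ({1..N} \<times> {1..N}))"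
    using i j by (intro Max_ge) force+
  finally show "norm (x i s - x j t) \<le> diam_initial N T yinit x"
    by (simp add: diam_initial_def)
qed

section \<open>From directional decay to decay of the diameter\<close>

text \<open>The distance of two current positions is tested in its own direction
  \<open>v = p - q\<close>. The upper bounds for \<open>v\<close> and \<open>- v\<close> decay at
  the same rate, their sum starts at most at \<open>norm v * D\<close>, and one factor
  \<open>norm v\<close> cancels.\<close>

lemma diam_leader_decay:
  assumes sol: "is_solution N \<tau> chi \<psi> \<phi> xinit yinit x y0"
    and N: "N \<ge> 1"
    and \<tau>: "\<And>i j. i \<in> {1..N} \<Longrightarrow> j \<in> {1..N} \<Longrightarrow> \<tau> i j > 0"
    and weight: "\<And>i j t. i \<in> {1..N} \<Longrightarrow> j \<in> {1..N} \<Longrightarrow> 0 \<le> chi i j * weight_b \<tau> \<psi> x i j t"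
    and \<gamma>: "\<gamma> \<ge> 0"
    and rate: "\<And>i t. i \<in> {1..N} \<Longrightarrow> t > 0 \<Longrightarrow>
        (1 / real N) * (\<Sum>j\<in>{1..N} - {i}. chi i j * weight_b \<tau> \<psi> x i j t *
            (exp (\<gamma> * max_delay N \<tau>) - 1)) + \<gamma> < weight_c \<phi> yinit x i t / real N"
    and t: "t \<ge> 0"
  shows "diam_leader N yinit x t \<le> diam_initial N (max_delay N \<tau>) yinit x * exp (- \<gamma> * t)"
proof -
  define T where "T = max_delay N \<tau>"
  define D where "D = diam_initial N T yinit x"
  \<comment> \<open>The inserted \<open>0\<close> is the leader in centered coordinates. It puts
    distances to the leader and distances between agents on the same footing, and it forces
    \<open>M\<close> and \<open>M'\<close> to be nonnegative.\<close>
  define P where "P = insert 0 (\<Union>i\<in>{1..N}. (\<lambda>s. x i s - yinit) ` {-T..0})"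
  define Q where "Q = insert 0 ((\<lambda>i. x i t - yinit) ` {1..N})"
  have one: "1 \<in> {1..N}" using N by simp
  have T: "T \<ge> 0" using max_delay_ge[OF one one, of \<tau>] \<tau>[OF one one] by (simp add: T_def)
  have cont: "continuous_on {-T..0} (x i)" if "i \<in> {1..N}" for i
    by (rule solution_continuous_on[OF sol that]) (auto simp: T_def)
  have z: "norm (x i s - yinit) \<le> D" if "i \<in> {1..N}" "s \<in> {-T..0}" for i s
    unfolding D_def using that by (intro diam_initial_bounds(1)[OF cont])
  have zz: "norm (x i s - x j r) \<le> D" if "i \<in> {1..N}" "s \<in> {-T..0}" "j \<in> {1..N}" "r \<in> {-T..0}" for i j s r
    unfolding D_def using that by (intro diam_initial_bounds(2)[OF cont])
  have "0 \<le> norm (x 1 0 - yinit)" by simp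
  also have "\<dots> \<le> D" using z[OF one, of 0] T by simp
  finally have D: "D \<ge> 0" .
  have PD: "norm (p - q) \<le> D" if "p \<in> P" "q \<in> P" for p q
    using that z zz D by (auto simp: P_def norm_minus_commute)
  have key: "norm (p - q) \<le> D * exp (- \<gamma> * t)" if pq: "p \<in> Q" "q \<in> Q" for p q
  proof -
    define v where "v = p - q"
    obtain M M' where M: "\<And>p. p \<in> P \<Longrightarrow> v \<bullet> p \<le> M" and M': "\<And>p. p \<in> P \<Longrightarrow> - v \<bullet> p \<le> M'"
      and MM: "M + M' \<le> norm v * D"
      using inner_widths_le_diameter[of P D v] PD by (metis P_def insert_not_empty)
    have nonneg: "M \<ge> 0" "M' \<ge> 0" using M[of 0] M'[of 0] by (auto simp: P_def)
    have decay: "w \<bullet> y \<le> K * exp (- \<gamma> * t)"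
      if w: "\<And>p. p \<in> P \<Longrightarrow> w \<bullet> p \<le> K" and K: "K \<ge> 0" and y: "y \<in> Q" for w K y
    proof (cases "y = 0")
      case False
      then obtain i where i: "i \<in> {1..N}" "y = x i t - yinit" using y by (auto simp: Q_def)
      show ?thesis unfolding i(2)
      proof (rule solution_inner_decay[OF sol \<tau> weight \<gamma> rate K _ i(1)])
        fix j s assume "j \<in> {1..N}" "s \<in> {- max_delay N \<tau>..0}"
        then show "w \<bullet> (x j s - yinit) \<le> K" by (intro w) (force simp: P_def T_def)
      qed (use t T in \<open>auto simp: T_def\<close>)
    qed (use K in auto)
    have "norm v * norm v = v \<bullet> (p - q)"
      by (simp add: v_def power2_norm_eq_inner flip: power2_eq_square)
    also have "\<dots> = v \<bullet> p + - v \<bullet> q"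
      by (simp add: inner_diff_right inner_minus_left)
    also have "\<dots> \<le> M * exp (- \<gamma> * t) + M' * exp (- \<gamma> * t)"
      using decay[OF M nonneg(1) pq(1)] decay[OF M' nonneg(2) pq(2)] by linarith
    also have "\<dots> = (M + M') * exp (- \<gamma> * t)" by (simp add: algebra_simps)
    also have "\<dots> \<le> norm v * (D * exp (- \<gamma> * t))"
      using MM by (simp flip: mult.assoc)
    \<comment> \<open>Cancelling \<open>norm v\<close> needs \<open>v\<close> nonzero; otherwise the
      left side vanishes and \<open>D \<ge> 0\<close> suffices.\<close>
    finally show ?thesis using D by (cases "v = 0") (auto simp: v_def)
  qed
  have Q: "0 \<in> Q" "\<And>i. i \<in> {1..N} \<Longrightarrow> x i t - yinit \<in> Q" by (auto simp: Q_def)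
  have "norm (x i t - yinit) \<le> D * exp (- \<gamma> * t)" if "i \<in> {1..N}" for i
    using key[OF Q(2)[OF that] Q(1)] by simp
  moreover have "norm (x i t - x j t) \<le> D * exp (- \<gamma> * t)" if "i \<in> {1..N}" "j \<in> {1..N}" for i j
    using key[OF Q(2)[OF that(1)] Q(2)[OF that(2)]] by simp
  ultimately have "diam_leader N yinit x t \<le> D * exp (- \<gamma> * t)"
    unfolding diam_leader_def using N by (intro max.boundedI Max.boundedI) auto
  then show ?thesis by (simp add: D_def T_def)
qed

section \<open>Existence of an admissible rate\<close>

theorem theorem4p9:
  fixes N :: nat
    and \<tau> chi :: "nat \<Rightarrow> nat \<Rightarrow> real"
    and \<psi> :: "nat \<Rightarrow> nat \<Rightarrow> (real^'d) \<times> (real^'d) \<Rightarrow> real"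
    and \<phi> :: "nat \<Rightarrow> (real^'d) \<times> (real^'d) \<Rightarrow> real"
    and xinit x :: "nat \<Rightarrow> real \<Rightarrow> real^'d"
    and yinit :: "real^'d"
    and y0 :: "real \<Rightarrow> real^'d"
  assumes "N \<ge> 3"
    and "\<And>i j. i \<in> {1..N} \<Longrightarrow> j \<in> {1..N} \<Longrightarrow> \<tau> i j > 0"
    and "\<And>i j. i \<in> {1..N} \<Longrightarrow> j \<in> {1..N} \<Longrightarrow> chi i j \<in> {0, 1}"
    and "\<And>i j. i \<in> {1..N} \<Longrightarrow> j \<in> {1..N} \<Longrightarrow>
           continuous_on UNIV (\<psi> i j) \<and> (\<forall>p. \<psi> i j p > 0) \<and> bounded (range (\<psi> i j))"
    and "\<And>i. i \<in> {1..N} \<Longrightarrow>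
           continuous_on UNIV (\<phi> i) \<and> (\<forall>p. \<phi> i p > 0) \<and> bounded (range (\<phi> i))"
    and "\<And>i. i \<in> {1..N} \<Longrightarrow> continuous_on {- max_delay N \<tau>..0} (xinit i)"
    and "is_solution N \<tau> chi \<psi> \<phi> xinit yinit x y0"
  shows "\<exists>\<gamma>>0. \<forall>t\<ge>0.
           diam_leader N yinit x t
             \<le> diam_initial N (max_delay N \<tau>) yinit x * exp (- \<gamma> * (t - 2 * max_delay N \<tau>))"
proof -
  define T where "T = max_delay N \<tau>"
  define D where "D = diam_initial N T yinit x"
  have N: "N \<ge> 1" using assms(1) by simp
  have one: "1 \<in> {1..N}" using N by simp
  have T: "T \<ge> 0" using max_delay_ge[OF one one, of \<tau>] assms(2)[OF one one] by (simp add: T_def)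
  note decay = diam_leader_decay[OF assms(7) N assms(2)]
  have weight: "0 \<le> chi i j * weight_b \<tau> \<psi> x i j t" if "i \<in> {1..N}" "j \<in> {1..N}" for i j t
    using assms(3)[OF that] assms(4)[OF that] by (auto simp: weight_b_def intro: less_imp_le)
  \<comment> \<open>For \<gamma> = 0 the factor \<open>exp (\<gamma> * T) - 1\<close> vanishes, so
    the rate condition is just positivity of the leader's weight.\<close>
  have "diam_leader N yinit x t \<le> D" if "t \<ge> 0" for t
  proof -
    have "diam_leader N yinit x t \<le> diam_initial N (max_delay N \<tau>) yinit x * exp (- 0 * t)"
      by (rule decay[OF _ _ weight _ _ that]) (use N assms(5) in \<open>auto simp: weight_c_def\<close>)
    then show ?thesis by (simp add: D_def T_def)
  qed
  moreover have "dist yinit (x i t) \<le> diam_leader N yinit x t" if "i \<in> {1..N}" for i t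
    unfolding diam_leader_def dist_norm norm_minus_commute[of yinit] using that
    by (intro max.coboundedI1 Max_ge) auto
  ultimately have ball: "x i t \<in> cball yinit D" if "i \<in> {1..N}" "t \<ge> 0" for i t
    using that by (metis mem_cball order_trans)
  \<comment> \<open>Positivity of \<open>\<phi> i\<close> alone gives no uniform lower bound; on the
    compact set \<open>cball yinit D \<times> {yinit}\<close>, which contains all relevant
    arguments, the positive minimum is attained.\<close>
  have "\<exists>c>0. \<forall>t>0. c \<le> weight_c \<phi> yinit x i t" if i: "i \<in> {1..N}" for i
  proof -
    have "compact (cball yinit D \<times> {yinit})" by (intro compact_Times) auto
    moreover have "cball yinit D \<times> {yinit} \<noteq> {}" using ball[OF i, of 0] by blast
    moreover have "continuous_on (cball yinit D \<times> {yinit}) (\<phi> i)"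
      using assms(5)[OF i] continuous_on_subset by blast
    ultimately obtain p where p: "\<And>q. q \<in> cball yinit D \<times> {yinit} \<Longrightarrow> \<phi> i p \<le> \<phi> i q"
      using continuous_attains_inf by metis
    have "\<phi> i p \<le> weight_c \<phi> yinit x i t" if "t > 0" for t
      unfolding weight_c_def using ball[OF i, of t] that by (intro p) auto
    then show ?thesis using assms(5)[OF i] by blast
  qed
  then obtain c' where c': "\<And>i. i \<in> {1..N} \<Longrightarrow> c' i > 0"
    "\<And>i t. i \<in> {1..N} \<Longrightarrow> t > 0 \<Longrightarrow> c' i \<le> weight_c \<phi> yinit x i t" by metis
  define c where "c = Min (c' ` {1..N})"
  have c: "c > 0" unfolding c_def using c'(1) N by (subst Min_gr_iff) auto
  have cw: "c \<le> weight_c \<phi> yinit x i t" if "i \<in> {1..N}" "t > 0" for i t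
  proof -
    have "c \<le> c' i" unfolding c_def using that by (intro Min_le) auto
    then show ?thesis using c'(2)[OF that] by linarith
  qed
  have "\<exists>B. \<forall>p. \<psi> i j p \<le> B" if "i \<in> {1..N}" "j \<in> {1..N}" for i j
    using assms(4)[OF that] bounded_imp_bdd_above[of "range (\<psi> i j)"] by (auto simp: bdd_above_def)
  then obtain B where B: "\<And>i j p. i \<in> {1..N} \<Longrightarrow> j \<in> {1..N} \<Longrightarrow> \<psi> i j p \<le> B i j" by metis
  \<comment> \<open>The double sum dominates every row sum, since all \<open>B i j\<close> are
    nonnegative; one constant thus serves all agents and times.\<close>
  define W where "W = (\<Sum>i\<in>{1..N}. \<Sum>j\<in>{1..N}. B i j)"
  have Bpos: "0 \<le> B i j" if "i \<in> {1..N}" "j \<in> {1..N}" for i j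
    using assms(4)[OF that] B[OF that] by (meson less_imp_le order_trans)
  have W: "(\<Sum>j\<in>{1..N} - {i}. chi i j * weight_b \<tau> \<psi> x i j t) \<le> W" if i: "i \<in> {1..N}" for i t
  proof -
    have "(\<Sum>j\<in>{1..N} - {i}. chi i j * weight_b \<tau> \<psi> x i j t) \<le> (\<Sum>j\<in>{1..N} - {i}. B i j)"
    proof (rule sum_mono)
      fix j assume "j \<in> {1..N} - {i}"
      then have j: "j \<in> {1..N}" by simp
      show "chi i j * weight_b \<tau> \<psi> x i j t \<le> B i j"
        using assms(3)[OF i j] B[OF i j] Bpos[OF i j] by (auto simp: weight_b_def)
    qed
    also have "\<dots> \<le> (\<Sum>j\<in>{1..N}. B i j)" using Bpos[OF i] by (intro sum_mono2) auto
    also have "\<dots> \<le> W"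
      unfolding W_def using i Bpos
      by (intro member_le_sum[of i _ "\<lambda>i. \<Sum>j\<in>{1..N}. B i j"] sum_nonneg) auto
    finally show ?thesis .
  qed
  \<comment> \<open>As \<gamma> tends to 0 from the right, the cost of the delays and of the descent
    tends to 0, while the leader's strength stays at least \<open>c / real N\<close>; hence small
    positive rates are admissible.\<close>
  have "((\<lambda>\<gamma>. W / real N * (exp (\<gamma> * T) - 1) + \<gamma>) \<longlongrightarrow> W / real N * (exp (0 * T) - 1) + 0) (at_right 0)"
    by (intro tendsto_intros)
  moreover have "W / real N * (exp (0 * T) - 1) + 0 < c / real N" using c N by simp
  ultimately have "\<forall>\<^sub>F \<gamma> in at_right 0. W / real N * (exp (\<gamma> * T) - 1) + \<gamma> < c / real N"
    by (rule order_tendstoD)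
  then obtain b where b: "b > 0" "\<And>\<gamma>. \<gamma> > 0 \<Longrightarrow> \<gamma> < b \<Longrightarrow> W / real N * (exp (\<gamma> * T) - 1) + \<gamma> < c / real N"
    by (auto simp: eventually_at_right_field)
  define \<gamma> where "\<gamma> = b / 2"
  have "\<gamma> > 0" "\<gamma> < b" using b(1) by (auto simp: \<gamma>_def)
  then have \<gamma>: "\<gamma> > 0" "W / real N * (exp (\<gamma> * T) - 1) + \<gamma> < c / real N"
    by (blast intro: b(2))+
  have rate: "(1 / real N) * (\<Sum>j\<in>{1..N} - {i}. chi i j * weight_b \<tau> \<psi> x i j t *
      (exp (\<gamma> * max_delay N \<tau>) - 1)) + \<gamma> < weight_c \<phi> yinit x i t / real N"
    if it: "i \<in> {1..N}" "t > 0" for i t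
  proof -
    let ?S = "\<Sum>j\<in>{1..N} - {i}. chi i j * weight_b \<tau> \<psi> x i j t"
    have "?S / real N * (exp (\<gamma> * T) - 1) \<le> W / real N * (exp (\<gamma> * T) - 1)"
      using W[OF it(1)] \<gamma> T by (intro mult_right_mono divide_right_mono) auto
    moreover have "c / real N \<le> weight_c \<phi> yinit x i t / real N" using cw[OF it] by (intro divide_right_mono) auto
    ultimately have "?S / real N * (exp (\<gamma> * T) - 1) + \<gamma> < weight_c \<phi> yinit x i t / real N"
      using \<gamma>(2) by linarith
    then show ?thesis by (simp add: T_def flip: sum_distrib_right)
  qed
  \<comment> \<open>The ball of radius \<open>D\<close> contains a point of the solution, so its
    radius cannot be negative.\<close>
  have D: "D \<ge> 0" using ball[OF one, of 0] by (metis cball_eq_empty empty_iff not_le order_refl)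
  show ?thesis
  proof (intro exI[of _ \<gamma>] conjI allI impI)
    fix t :: real assume t: "t \<ge> 0"
    have "diam_leader N yinit x t \<le> D * exp (- \<gamma> * t)"
      using decay[OF _ _ weight _ rate t] \<gamma> by (simp add: D_def T_def)
    also have "\<dots> \<le> D * exp (- \<gamma> * (t - 2 * T))"
      using D \<gamma> T by (intro mult_left_mono) auto
    finally show "diam_leader N yinit x t
        \<le> diam_initial N (max_delay N \<tau>) yinit x * exp (- \<gamma> * (t - 2 * max_delay N \<tau>))"
      by (simp add: D_def T_def)
  qed (rule \<gamma>(1))
qed

end
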